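(* Assume that $u$ is bounded on $[0,+\infty)\times\mathbf Z$ and solves $$\dot u_i(t)=d'_i(u_{i+1}(t)-u_i(t))+d_i(u_{i-1}(t)-u_i(t))+f(i,u_i(t)),\qquad t>0,\ i\in\mathbf Z,$$ with $0\le u(0,i)\le 1$ for all $i$ and $\{i\in\mathbf Z: u(0,i)\neq0\}$ nonempty and finite. Then for every $T>0$ there exists a positive constant $\theta(T)$, depending only on $T$ (and in particular not on $t$ and $i$), such that for all $(t,i)\in[0,+\infty)\times\mathbf Z$ $$u_i(t)\le\theta(T)\,u_j(t+T),\qquad j\in\{i-1,i,i+1\}.$$
   Context: Standing assumptions. $(d_i)_{i\in\mathbf Z}$, $(d'_i)_{i\in\mathbf Z}$ are fixed real sequences with $0<\inf_i d_i\le\sup_i d_i<\infty$ and $0<\inf_i d'_i\le\sup_i d'_i<\infty$. The function $f:\mathbf Z\times[0,1]\to\mathbf R$ satisfies: $f(i,0)=f(i,1)=0$ for all $i$; $0<\inf_j f(j,s)\le f(i,s)\le f'_s(i,0)s$ for all $i\in\mathbf Z$ and $s\in(0,1)$; for some Hölder exponent $\gamma\in(0,1]$, $\sup_i\|f(i,\cdot)\|_{C^{1+\gamma}([0,1])}<\infty$; and $\liminf_{|i|\to\infty}\big(f'_s(i,0)-(\sqrt{d'_i}-\sqrt{d_i})^2\big)>0$. Here $f'_s(i,0)$ is the derivative of $s\mapsto f(i,s)$ at $s=0$. Solutions $u$ take values in $[0,1]$. The coefficients $d_i,d'_i$ are regarded as fixed, so "depending only on $T$" allows dependence on them. *)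

theory Defs
  imports "HOL-Analysis.Analysis"
begin

text \<open>Infima, suprema and limits inferior are taken in \<^typ>\<open>ereal\<close>, so that they have
  their usual meaning without separate boundedness side conditions.\<close>

definition admissible_coeff :: "(int \<Rightarrow> real) \<Rightarrow> bool" where
  "admissible_coeff d \<longleftrightarrow> 0 < (INF i. ereal (d i)) \<and> (SUP i. ereal (d i)) < \<infinity>"

text \<open>Derivative of a function on \<open>[0,1]\<close>, one-sided at the end points; values
  outside \<open>[0,1]\<close> play no role.\<close>

definition deriv01 :: "(real \<Rightarrow> real) \<Rightarrow> real \<Rightarrow> real" where
  "deriv01 g s = vector_derivative g (at s within {0..1})"

text \<open>The norm of \<open>C\<^sup>1\<^sup>+\<^sup>\<gamma>([0,1])\<close>; meaningful only for functions differentiable on \<open>[0,1]\<close>.\<close>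

definition C1_holder_norm :: "real \<Rightarrow> (real \<Rightarrow> real) \<Rightarrow> ereal" where
  "C1_holder_norm \<gamma> g =
     (SUP s\<in>{0..1}. ereal \<bar>g s\<bar>) + (SUP s\<in>{0..1}. ereal \<bar>deriv01 g s\<bar>)
     + (SUP (r, s)\<in>{(r, s). r \<in> {0..1} \<and> s \<in> {0..1} \<and> r \<noteq> s}.
          ereal (\<bar>deriv01 g r - deriv01 g s\<bar> / \<bar>r - s\<bar> powr \<gamma>))"

definition admissible_reaction ::
    "(int \<Rightarrow> real) \<Rightarrow> (int \<Rightarrow> real) \<Rightarrow> (int \<Rightarrow> real \<Rightarrow> real) \<Rightarrow> bool" where
  "admissible_reaction d d' f \<longleftrightarrow>
     (\<forall>i. f i 0 = 0 \<and> f i 1 = 0) \<and>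
     (\<forall>i. \<forall>s\<in>{0<..<1}. 0 < (INF j. ereal (f j s)) \<and> (INF j. ereal (f j s)) \<le> ereal (f i s) \<and>
        f i s \<le> deriv01 (f i) 0 * s) \<and>
     (\<forall>i. f i differentiable_on {0..1}) \<and>
     (\<exists>\<gamma>. 0 < \<gamma> \<and> \<gamma> \<le> 1 \<and> (SUP i. C1_holder_norm \<gamma> (f i)) < \<infinity>) \<and>
     0 < Liminf (filtercomap (\<lambda>i. \<bar>i\<bar>) at_top)
           (\<lambda>i. ereal (deriv01 (f i) 0 - (sqrt (d' i) - sqrt (d i))\<^sup>2))"

text \<open>Here \<open>u i t\<close> is \<open>u\<^sub>i(t)\<close>. Solutions are continuous up to \<open>t = 0\<close>, which
  links the initial value to the evolution, and stay in \<open>[0,1]\<close>, where \<open>f i\<close> is defined.\<close>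

definition is_solution ::
    "(int \<Rightarrow> real) \<Rightarrow> (int \<Rightarrow> real) \<Rightarrow> (int \<Rightarrow> real \<Rightarrow> real) \<Rightarrow> (int \<Rightarrow> real \<Rightarrow> real) \<Rightarrow> bool" where
  "is_solution d d' f u \<longleftrightarrow>
     (\<forall>i. continuous_on {0..} (u i)) \<and>
     (\<forall>i. \<forall>t\<ge>0. u i t \<in> {0..1}) \<and>
     (\<forall>i. \<forall>t>0. (u i has_real_derivative
        d' i * (u (i + 1) t - u i t) + d i * (u (i - 1) t - u i t) + f i (u i t)) (at t))"

end

(* Since f is nonnegative on [0,1], u is a supersolution of the linear equation. With K bounding
   all d i + d' i, the function exp (K t) * u i t is nondecreasing, and its derivative is at least
   delta times the same function at i - 1 or at i + 1, where delta > 0 bounds all d i and d' i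
   from below. Integrating over [t, t + T] gives the claim. *)
theory Submission
  imports Defs
begin

text \<open>Density of the reals in \<open>ereal\<close> places a real number strictly between 0 and
  the infimum and another strictly between the supremum and \<infinity>. These serve as uniform
  bounds, with no need to show first that the infimum and supremum are finite.\<close>

lemma admissible_coeff_bounds:
  assumes "admissible_coeff d"
  obtains \<delta> K :: real where "0 < \<delta>" "\<And>i. \<delta> \<le> d i" "\<And>i. d i \<le> K"
proof -
  from assms have inf: "0 < (INF i. ereal (d i))" and sup: "(SUP i. ereal (d i)) < \<infinity>"
    by (auto simp: admissible_coeff_def)
  from ereal_dense2[OF inf] obtain \<delta> where \<delta>: "0 < ereal \<delta>" "ereal \<delta> < (INF i. ereal (d i))"
    by blast
  from ereal_dense2[OF sup] obtain K where K: "(SUP i. ereal (d i)) < ereal K"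
    by blast
  show thesis
  proof
    show "0 < \<delta>" using \<delta>(1) by simp
    show "\<delta> \<le> d i" for i
      using less_le_trans[OF \<delta>(2) INF_lower[of i UNIV]] by simp
    show "d i \<le> K" for i
      using le_less_trans[OF SUP_upper[of i UNIV] K] by simp
  qed
qed

lemma admissible_reaction_nonneg:
  assumes "admissible_reaction d d' f" "s \<in> {0..1}"
  shows "0 \<le> f i s"
proof (cases "s = 0 \<or> s = 1")
  case True
  then show ?thesis using assms(1) by (auto simp: admissible_reaction_def)
next
  case False
  then have "s \<in> {0<..<1}" using assms(2) by auto
  then have "0 < (INF j. ereal (f j s))" "(INF j. ereal (f j s)) \<le> ereal (f i s)"
    using assms(1) unfolding admissible_reaction_def by blast+
  then have "0 < ereal (f i s)" by (rule less_le_trans)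
  then show ?thesis by simp
qed

text \<open>The function \<open>g x - c * x\<close> has nonnegative derivative inside the interval.
  Derivatives are required only on the open interval, so that \<open>a = 0\<close> is allowed, where
  a solution is merely known to be continuous.\<close>

lemma increment_ge_of_deriv_ge:
  fixes g g' :: "real \<Rightarrow> real"
  assumes "a \<le> b" "continuous_on {a..b} g"
    and "\<And>x. a < x \<Longrightarrow> x < b \<Longrightarrow> (g has_real_derivative g' x) (at x)"
    and "\<And>x. a < x \<Longrightarrow> x < b \<Longrightarrow> c \<le> g' x"
  shows "c * (b - a) \<le> g b - g a"
proof -
  have "g a - c * a \<le> g b - c * b"
  proof (rule DERIV_nonneg_imp_increasing_open[OF assms(1)])
    show "\<exists>y. ((\<lambda>x. g x - c * x) has_real_derivative y) (at x) \<and> 0 \<le> y"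
      if "a < x" "x < b" for x
      using assms(3,4)[OF that]
      by (intro exI[of _ "g' x - c"]) (auto intro!: derivative_eq_intros)
  qed (intro continuous_intros assms)
  then show ?thesis by (simp add: algebra_simps)
qed

theorem theorem4p1:
  fixes d d' :: "int \<Rightarrow> real" and T :: real
  assumes "admissible_coeff d" and "admissible_coeff d'" and "T > 0"
  shows "\<exists>\<theta>>0. \<forall>(f :: int \<Rightarrow> real \<Rightarrow> real) (u :: int \<Rightarrow> real \<Rightarrow> real).
    admissible_reaction d d' f \<longrightarrow>
    is_solution d d' f u \<longrightarrow>
    bounded {u i t |i t. t \<ge> 0} \<longrightarrow>
    (\<forall>i. 0 \<le> u i 0 \<and> u i 0 \<le> 1) \<longrightarrow>
    {i. u i 0 \<noteq> 0} \<noteq> {} \<longrightarrow> finite {i. u i 0 \<noteq> 0} \<longrightarrow>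
    (\<forall>t\<ge>0. \<forall>i. \<forall>j\<in>{i - 1, i, i + 1}. u i t \<le> \<theta> * u j (t + T))"
proof -
  obtain \<delta>1 K1 where 1: "0 < \<delta>1" "\<And>i. \<delta>1 \<le> d i" "\<And>i. d i \<le> K1"
    using admissible_coeff_bounds[OF assms(1)] by blast
  obtain \<delta>2 K2 where 2: "0 < \<delta>2" "\<And>i. \<delta>2 \<le> d' i" "\<And>i. d' i \<le> K2"
    using admissible_coeff_bounds[OF assms(2)] by blast
  define \<delta> where "\<delta> = min \<delta>1 \<delta>2"
  define K where "K = K1 + K2"
  \<comment> \<open>The exponential pays for the change of weight between \<open>t\<close> and
    \<open>t + T\<close>; in the maximum, 1 serves \<open>j = i\<close> and
    \<open>1 / (\<delta> * T)\<close> serves the two neighbours. The choice precedes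
    \<open>f\<close> and \<open>u\<close>, hence is uniform in them.\<close>
  define \<theta> where "\<theta> = exp (K * T) * max 1 (1 / (\<delta> * T))"
  have \<delta>: "0 < \<delta>" "\<And>i. \<delta> \<le> d i" "\<And>i. \<delta> \<le> d' i"
    using 1(1,2) 2(1,2) by (simp_all add: \<delta>_def min.coboundedI1 min.coboundedI2)
  have K: "d i + d' i \<le> K" for i
    using 1(3) 2(3) by (auto simp: K_def intro: add_mono)
  have "u i t \<le> \<theta> * u j (t + T)"
    if f: "admissible_reaction d d' f" and u: "is_solution d d' f u"
      and t: "t \<ge> 0" and j: "j \<in> {i - 1, i, i + 1}" for f u t i j
  proof -
    have u_cont: "continuous_on {0..} (u k)" for k
      using u by (auto simp: is_solution_def)
    have u01: "u k s \<in> {0..1}" if "s \<ge> 0" for k s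
      using u that unfolding is_solution_def by blast
    have u_deriv: "(u k has_real_derivative
        d' k * (u (k + 1) s - u k s) + d k * (u (k - 1) s - u k s) + f k (u k s)) (at s)"
      if "s > 0" for k s
      using u that unfolding is_solution_def by blast
    define w where "w k s = exp (K * s) * u k s" for k s
    \<comment> \<open>This is the derivative of \<open>w k\<close> by the product rule: the weight
      contributes \<open>K * u k s\<close>, which turns the coefficient of \<open>u k s\<close> into
      the nonnegative \<open>K - d k - d' k\<close>.\<close>
    define w' where "w' k s = exp (K * s) * (d' k * u (k + 1) s + d k * u (k - 1) s
        + (K - d k - d' k) * u k s + f k (u k s))" for k s
    have w_cont: "continuous_on {a..b} (w k)" if "0 \<le> a" for a b k
      unfolding w_def using that
      by (intro continuous_intros continuous_on_subset[OF u_cont]) auto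
    have w_deriv: "(w k has_real_derivative w' k s) (at s)" if "s > 0" for k s
      unfolding w_def w'_def
      by (rule derivative_eq_intros u_deriv[OF that] refl)+ (simp add: algebra_simps)
    have w_nonneg: "0 \<le> w k s" if "s \<ge> 0" for k s
      using u01[OF that] by (simp add: w_def)
    have w'_ge: "\<delta> * w (k + 1) s + \<delta> * w (k - 1) s \<le> w' k s" if "s \<ge> 0" for k s
    proof -
      have "\<delta> * u (k + 1) s \<le> d' k * u (k + 1) s" "\<delta> * u (k - 1) s \<le> d k * u (k - 1) s"
        using \<delta> u01[OF that] by (auto intro!: mult_right_mono)
      moreover have "0 \<le> (K - d k - d' k) * u k s"
        using K[of k] u01[OF that] by (intro mult_nonneg_nonneg) auto
      moreover have "0 \<le> f k (u k s)"
        by (rule admissible_reaction_nonneg[OF f u01[OF that]])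
      ultimately have "\<delta> * u (k + 1) s + \<delta> * u (k - 1) s
          \<le> d' k * u (k + 1) s + d k * u (k - 1) s + (K - d k - d' k) * u k s + f k (u k s)"
        by linarith
      from mult_left_mono[OF this, of "exp (K * s)"] show ?thesis
        by (simp add: w_def w'_def algebra_simps)
    qed
    have w_mono: "w k a \<le> w k b" if "0 \<le> a" "a \<le> b" for k a b
    proof -
      have "0 * (b - a) \<le> w k b - w k a"
      proof (rule increment_ge_of_deriv_ge[OF that(2) w_cont[OF that(1)] w_deriv])
        fix s assume "a < s"
        then show "0 < s" "0 \<le> w' k s"
          using that w'_ge[of s k] w_nonneg[of s] \<delta>(1)
          by (auto intro!: order_trans[OF _ w'_ge] add_nonneg_nonneg)
      qed
      then show ?thesis by simp
    qed
    have step: "w i t \<le> max 1 (1 / (\<delta> * T)) * w j (t + T)"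
    proof (cases "j = i")
      case True
      have "w i t \<le> 1 * w i (t + T)" using w_mono t assms(3) by simp
      also have "\<dots> \<le> max 1 (1 / (\<delta> * T)) * w i (t + T)"
        using w_nonneg t assms(3) by (intro mult_right_mono) auto
      finally show ?thesis using True by simp
    next
      case False
      \<comment> \<open>Monotonicity of \<open>w i\<close> replaces its values after
        \<open>t\<close> by the constant \<open>w i t\<close>, so \<open>w j\<close> grows at least
        linearly on the interval from \<open>t\<close> to \<open>t + T\<close>.\<close>
      have "\<delta> * w i t * (t + T - t) \<le> w j (t + T) - w j t"
      proof (rule increment_ge_of_deriv_ge[OF _ w_cont[OF t] w_deriv])
        fix s assume s: "t < s"
        then have "s \<ge> 0" using t by simp
        have "\<delta> * w i t \<le> \<delta> * w i s"
          using s t \<delta>(1) w_mono by simp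
        \<comment> \<open>Here \<open>i\<close> is \<open>j + 1\<close> or \<open>j - 1\<close>, so
          one summand equals the left-hand side and the other is nonnegative.\<close>
        also have "\<dots> \<le> \<delta> * w (j + 1) s + \<delta> * w (j - 1) s"
          using j False w_nonneg[OF \<open>s \<ge> 0\<close>] \<delta>(1) by auto
        finally show "\<delta> * w i t \<le> w' j s"
          using w'_ge[OF \<open>s \<ge> 0\<close>, of j] by linarith
      qed (use assms(3) t in auto)
      then have "\<delta> * T * w i t \<le> w j (t + T)"
        using w_nonneg[OF t, of j] by (simp add: algebra_simps)
      then have "w i t \<le> 1 / (\<delta> * T) * w j (t + T)"
        using \<delta>(1) assms(3) by (simp add: field_simps)
      also have "\<dots> \<le> max 1 (1 / (\<delta> * T)) * w j (t + T)"
        using w_nonneg t assms(3) by (intro mult_right_mono) auto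
      finally show ?thesis .
    qed
    \<comment> \<open>The weight at \<open>t + T\<close> splits as
      \<open>exp (K * t) * exp (K * T)\<close>: the first factor cancels and the second is part of
      \<theta>, which removes the dependence on \<open>t\<close>.\<close>
    have "exp (K * t) * u i t \<le> exp (K * t) * (\<theta> * u j (t + T))"
      using step by (simp add: w_def \<theta>_def exp_add distrib_left algebra_simps)
    then show ?thesis by simp
  qed
  moreover have "\<theta> > 0" by (simp add: \<theta>_def)
  ultimately show ?thesis by blast
qed

end
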